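(* Let $(X,\rho)$ be an ultrametric space with $X$ infinite and let $G$ be a graph such that $V(G)=X$ and, for all distinct $u,v\in X$, $\{u,v\}\in E(G)$ if and only if $\{u,v\}$ is a $\rho$-diametrical pair of points for $X$. Then $G$ is a complete multipartite graph. Conversely, if $G=(V,E)$ is a complete multipartite graph with $V$ infinite, then there is an ultrametric $\rho:V\times V\rightarrow\mathbb{R}^+$ such that $E$ is the set of $\rho$-diametrical pairs of points for $V$.
   Context: $\mathbb{R}^+=[0,\infty)$. An ultrametric on a set $X$ is a metric $\rho:X\times X\to\mathbb{R}^+$ satisfying $\rho(x,y)\leqslant\max\{\rho(x,z),\rho(z,y)\}$ for all $x,y,z\in X$. For $A\subseteq X$, $\operatorname{diam}A=\sup\{\rho(x,y):x,y\in A\}$ (possibly $+\infty$). A two-element subset $\{a,b\}$ of $A$ is a $\rho$-diametrical pair for $A$ if $\rho(a,b)=\operatorname{diam}A$. All graphs are simple: a graph $G=(V,E)$ has a vertex set $V=V(G)$ (possibly infinite) and an edge set $E=E(G)$ consisting of two-element subsets of $V$. For a cardinal number $k$, a graph $G$ is $k$-partite if $V(G)$ can be partitioned into $k$ nonempty disjoint parts such that no edge has both ends in the same part; a $k$-partite graph is complete if any two vertices in different parts are adjacent. A graph is complete multipartite if it is complete $k$-partite for some cardinal $k\geqslant 1$ (so, for $k=1$, graphs with no edges are included). *)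

theory Defs
  imports "HOL-Analysis.Analysis" "HOL-Library.Disjoint_Sets"
begin

unbundle cardinal_syntax

(* As always for Metric_space, d is a total function on the type and is required to be
   nonnegative and symmetric everywhere; its values outside M are otherwise irrelevant. *)
locale Ultrametric_space = Metric_space +
  assumes strong_triangle:
    "\<lbrakk>x \<in> M; y \<in> M; z \<in> M\<rbrakk> \<Longrightarrow> d x y \<le> max (d x z) (d z y)"

(* The supremum is taken in [0, \<infinity>], so that unbounded sets have diameter \<infinity>. *)
definition diam :: "('a \<Rightarrow> 'a \<Rightarrow> real) \<Rightarrow> 'a set \<Rightarrow> ennreal" where
  "diam \<rho> A = (SUP (x, y) \<in> A \<times> A. ennreal (\<rho> x y))"

definition diametrical_pair :: "('a \<Rightarrow> 'a \<Rightarrow> real) \<Rightarrow> 'a set \<Rightarrow> 'a set \<Rightarrow> bool" where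
  "diametrical_pair \<rho> A e \<longleftrightarrow>
     (\<exists>a\<in>A. \<exists>b\<in>A. a \<noteq> b \<and> e = {a, b} \<and> ennreal (\<rho> a b) = diam \<rho> A)"

definition simple_graph :: "'a set \<Rightarrow> 'a set set \<Rightarrow> bool" where
  "simple_graph V E \<longleftrightarrow> (\<forall>e\<in>E. e \<subseteq> V \<and> card e = 2)"

(* A cardinal number is a relation k with Card_order k, as in the HOL theory of cardinals. *)
definition k_partition_of ::
    "'k rel \<Rightarrow> 'a set \<Rightarrow> 'a set set \<Rightarrow> 'a set set \<Rightarrow> bool" where
  "k_partition_of k V E P \<longleftrightarrow>
     partition_on V P \<and> |P| =o k \<and> (\<forall>e\<in>E. \<forall>p\<in>P. \<not> e \<subseteq> p)"

definition complete_k_partite :: "'k rel \<Rightarrow> 'a set \<Rightarrow> 'a set set \<Rightarrow> bool" where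
  "complete_k_partite k V E \<longleftrightarrow> simple_graph V E \<and>
     (\<exists>P. k_partition_of k V E P \<and>
          (\<forall>p\<in>P. \<forall>q\<in>P. p \<noteq> q \<longrightarrow> (\<forall>u\<in>p. \<forall>v\<in>q. {u, v} \<in> E)))"

(* Every set of parts is a subset of Pow V, so its cardinality is realised by a cardinal on
   the type 'a set; quantifying over cardinals on this type loses nothing. *)
definition complete_multipartite :: "'a set \<Rightarrow> 'a set set \<Rightarrow> bool" where
  "complete_multipartite V E \<longleftrightarrow>
     (\<exists>k :: 'a set rel. Card_order k \<and> cone \<le>o k \<and> complete_k_partite k V E)"

end

theory Submission
  imports Defs
begin

text \<open>In an ultrametric space with at least two points, being at distance less than the diameter is
  an equivalence relation, and its classes are the parts of the graph of diametrical pairs.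
  Conversely, if the graph has an edge, give distinct points distance \<open>1\<close> or \<open>2\<close> according to
  whether they share a part. If it has none, the distance \<open>max (h x) (h y)\<close> for an unbounded
  positive weight \<open>h\<close> has infinite diameter, hence no diametrical pair; this is where
  infiniteness of the vertex set is needed.\<close>

lemma diam_upper: "x \<in> A \<Longrightarrow> y \<in> A \<Longrightarrow> ennreal (\<rho> x y) \<le> diam \<rho> A"
  unfolding diam_def by (rule SUP_upper2[of "(x, y)"]) auto

lemma diam_eq_attained:
  assumes "a \<in> A" "b \<in> A" "\<rho> a b = r" "\<And>x y. x \<in> A \<Longrightarrow> y \<in> A \<Longrightarrow> \<rho> x y \<le> r"
  shows "diam \<rho> A = ennreal r"
proof (rule antisym)
  show "diam \<rho> A \<le> ennreal r"
    unfolding diam_def using assms(4) by (auto intro!: SUP_least ennreal_leI)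
  show "ennreal r \<le> diam \<rho> A"
    using diam_upper[OF assms(1,2), of \<rho>] assms(3) by simp
qed

text \<open>A doubleton forgets the order of its points, so the witnesses in the definition may come
  swapped; symmetry of the distance undoes the swap.\<close>

lemma diametrical_pair_doubleton:
  assumes "\<And>x y. \<rho> x y = \<rho> y x"
  shows "diametrical_pair \<rho> A {a, b} \<longleftrightarrow>
    a \<in> A \<and> b \<in> A \<and> a \<noteq> b \<and> ennreal (\<rho> a b) = diam \<rho> A"
  unfolding diametrical_pair_def doubleton_eq_iff using assms by metis

text \<open>Transitivity is the strong triangle inequality: the maximum of two distances below the
  diameter is below it. Reflexivity is where the diameter must be positive.\<close>

lemma (in Ultrametric_space) equiv_less_diam:
  assumes "diam d M > 0"
  shows "equiv M {(x, y). x \<in> M \<and> y \<in> M \<and> ennreal (d x y) < diam d M}"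
proof (rule equivI)
  show "trans {(x, y). x \<in> M \<and> y \<in> M \<and> ennreal (d x y) < diam d M}"
  proof (rule transI, clarsimp)
    fix x y z
    assume *: "x \<in> M" "y \<in> M" "z \<in> M" "ennreal (d x y) < diam d M" "ennreal (d y z) < diam d M"
    have "ennreal (d x z) \<le> ennreal (max (d x y) (d y z))"
      using strong_triangle[of x z y] * by (intro ennreal_leI)
    also have "\<dots> < diam d M"
      using *(4,5) by (simp add: max_def)
    finally show "ennreal (d x z) < diam d M" .
  qed
qed (use assms in \<open>auto intro!: refl_onI symI simp: commute\<close>)

text \<open>The classes of the relation from \<open>equiv_less_diam\<close> serve as the parts. If
  the diameter is infinite or not attained, there is a single class and the graph has no
  edges.\<close>

lemma (in Ultrametric_space) complete_multipartite_diametrical: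
  assumes "infinite M" and "simple_graph M E"
    and E: "\<And>u v. \<lbrakk>u \<in> M; v \<in> M; u \<noteq> v\<rbrakk> \<Longrightarrow> {u, v} \<in> E \<longleftrightarrow> diametrical_pair d M {u, v}"
  shows "complete_multipartite M E"
proof -
  obtain a where a: "a \<in> M" using \<open>infinite M\<close> by fastforce
  obtain b where b: "b \<in> M" "b \<noteq> a"
    using infinite_remove[OF \<open>infinite M\<close>, of a] by (metis Diff_iff finite.emptyI insertI1 all_not_in_conv)
  have "ennreal (d a b) > 0" using a b by simp
  then have pos: "diam d M > 0" using diam_upper[OF a b(1), of d] by order
  define R where "R = {(x, y). x \<in> M \<and> y \<in> M \<and> ennreal (d x y) < diam d M}"
  have R: "equiv M R" unfolding R_def by (rule equiv_less_diam[OF pos])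
  \<comment> \<open>For \<open>u = v\<close> both sides are false: a simple graph has no loops, and
    \<open>R\<close> is reflexive by \<open>pos\<close>. For distinct points, a distance that is not
    below the diameter equals it.\<close>
  have edge: "{u, v} \<in> E \<longleftrightarrow> (u, v) \<notin> R" if "u \<in> M" "v \<in> M" for u v
  proof (cases "u = v")
    case True
    then show ?thesis
      using assms(2) pos that by (auto simp: simple_graph_def R_def)
  next
    case False
    then show ?thesis
      using E[OF that False] that diam_upper[OF that, of d]
      by (auto simp: diametrical_pair_doubleton commute R_def)
  qed
  have part: "partition_on M (M // R)"
    by (rule partition_on_quotient[OF R])
  have "k_partition_of |M // R| M E (M // R)"
    unfolding k_partition_of_def
  proof (intro conjI ballI notI)
    fix e p assume e: "e \<in> E" and p: "p \<in> M // R" "e \<subseteq> p"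
    obtain u v where uv: "e = {u, v}"
      using assms(2) e by (auto simp: simple_graph_def card_2_iff)
    then have "(u, v) \<in> R"
      using p quotient_eq_iff[OF R p(1) p(1)] by auto
    with edge[of u v] e uv show False by (auto simp: R_def)
  qed (use part card_of_refl in auto)
  moreover have "{u, v} \<in> E"
    if "p \<in> M // R" "q \<in> M // R" "p \<noteq> q" "u \<in> p" "v \<in> q" for p q u v
    using that edge[of u v] quotient_eq_iff[OF R that(1,2,4,5)] in_quotient_imp_subset[OF R] by blast
  ultimately have "complete_k_partite |M // R| M E"
    unfolding complete_k_partite_def using assms(2) by blast
  moreover have "M // R \<noteq> {}"
    using a by (auto simp: quotient_def)
  then have "cone \<le>o |M // R|"
    by (intro cone_ordLeq_Cnotzero) (simp add: card_of_ordIso_czero_iff_empty card_of_Card_order)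
  ultimately show ?thesis
    unfolding complete_multipartite_def using card_of_Card_order by blast
qed

text \<open>Independence of the parts and completeness between them determine the edge set from
  \<open>P\<close> alone. Distinctness of \<open>u\<close> and \<open>v\<close> is implicit, since
  \<open>{u, u}\<close> lies inside the part containing \<open>u\<close>.\<close>

lemma complete_multipartite_obtain_partition:
  assumes "complete_multipartite V E"
  obtains P where "partition_on V P"
    and "\<And>e. e \<in> E \<longleftrightarrow> (\<exists>u\<in>V. \<exists>v\<in>V. e = {u, v} \<and> (\<forall>p\<in>P. \<not> {u, v} \<subseteq> p))"
proof -
  obtain P where sg: "simple_graph V E" and part: "partition_on V P"
    and indep: "\<And>e p. e \<in> E \<Longrightarrow> p \<in> P \<Longrightarrow> \<not> e \<subseteq> p"
    and compl: "\<And>p q u v. \<lbrakk>p \<in> P; q \<in> P; p \<noteq> q; u \<in> p; v \<in> q\<rbrakk> \<Longrightarrow> {u, v} \<in> E"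
    using assms unfolding complete_multipartite_def complete_k_partite_def k_partition_of_def
    by metis
  show ?thesis
  proof (rule that[OF part])
    fix e
    show "e \<in> E \<longleftrightarrow> (\<exists>u\<in>V. \<exists>v\<in>V. e = {u, v} \<and> (\<forall>p\<in>P. \<not> {u, v} \<subseteq> p))"
    proof
      assume "e \<in> E"
      moreover from this obtain u v where "e = {u, v}" "u \<in> V" "v \<in> V"
        using sg by (force simp: simple_graph_def card_2_iff)
      ultimately show "\<exists>u\<in>V. \<exists>v\<in>V. e = {u, v} \<and> (\<forall>p\<in>P. \<not> {u, v} \<subseteq> p)"
        using indep by blast
    next
      assume "\<exists>u\<in>V. \<exists>v\<in>V. e = {u, v} \<and> (\<forall>p\<in>P. \<not> {u, v} \<subseteq> p)"
      then obtain u v where uv: "u \<in> V" "v \<in> V" "e = {u, v}" "\<forall>p\<in>P. \<not> {u, v} \<subseteq> p"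
        by blast
      obtain p q where "p \<in> P" "u \<in> p" "q \<in> P" "v \<in> q"
        using uv(1,2) partition_onD1[OF part] by blast
      with uv show "e \<in> E" using compl[of p q u v] by auto
    qed
  qed
qed

text \<open>The strong triangle inequality could only fail as \<open>2 \<le> 1\<close>. That would
  need \<open>x\<close> and \<open>z\<close>, and also \<open>z\<close> and \<open>y\<close>, to
  share a part without \<open>x\<close> and \<open>y\<close> doing so; since parts are disjoint, the
  two parts containing \<open>z\<close> coincide.\<close>

lemma Ultrametric_space_partition:
  assumes "partition_on V P"
  shows "Ultrametric_space V
    (\<lambda>x y. if x = y then 0 else if \<exists>p\<in>P. {x, y} \<subseteq> p then 1 else 2)"
proof -
  define S where "S x y \<longleftrightarrow> (\<exists>p\<in>P. {x, y} \<subseteq> p)" for x y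
  have sym: "S x y \<longleftrightarrow> S y x" for x y
    unfolding S_def by (simp add: insert_commute)
  have tr: "S x y" if xzy: "S x z" "S z y" for x y z
  proof -
    obtain p q where pq: "p \<in> P" "{x, z} \<subseteq> p" "q \<in> P" "{z, y} \<subseteq> q"
      using xzy unfolding S_def by metis
    then have "p = q"
      using disjointD[OF partition_onD2[OF assms], of p q] by auto
    with pq show ?thesis unfolding S_def by auto
  qed
  have "Ultrametric_space V (\<lambda>x y. if x = y then 0 else if S x y then 1 else 2)"
  proof
    fix x y z
    show "(if x = y then 0 else if S x y then 1 else 2 :: real) =
        (if y = x then 0 else if S y x then 1 else 2)"
      using sym[of x y] by simp
    show "(if x = y then 0 else if S x y then 1 else 2 :: real) \<le>
        max (if x = z then 0 else if S x z then 1 else 2) (if z = y then 0 else if S z y then 1 else 2)"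
      using tr[of x z y] by auto
  qed auto
  then show ?thesis
    unfolding S_def .
qed

text \<open>A pair split by the parts attains the largest possible distance, so the diameter is 2.
  Without such a pair, distinct points would all be at distance 1 and every pair would be
  diametrical, which is why edgeless graphs require another metric.\<close>

lemma diametrical_pair_partition:
  assumes "\<exists>u\<in>V. \<exists>v\<in>V. \<forall>p\<in>P. \<not> {u, v} \<subseteq> p" and "partition_on V P"
  shows "diametrical_pair (\<lambda>x y. if x = y then 0 else if \<exists>p\<in>P. {x, y} \<subseteq> p then 1 else 2) V e
    \<longleftrightarrow> (\<exists>u\<in>V. \<exists>v\<in>V. e = {u, v} \<and> (\<forall>p\<in>P. \<not> {u, v} \<subseteq> p))"
    (is "diametrical_pair ?d V e \<longleftrightarrow> _")
proof -
  have ne: "u \<noteq> v" if "u \<in> V" "\<forall>p\<in>P. \<not> {u, v} \<subseteq> p" for u v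
    using that partition_onD1[OF assms(2)] by blast
  obtain a b where ab: "a \<in> V" "b \<in> V" "\<forall>p\<in>P. \<not> {a, b} \<subseteq> p"
    using assms(1) by blast
  have "diam ?d V = ennreal 2"
    by (rule diam_eq_attained[OF ab(1,2)]) (use ab ne[of a b] in auto)
  then show ?thesis
    unfolding diametrical_pair_def using ne by (auto split: if_splits)
qed

text \<open>On a path from \<open>x\<close> to \<open>y\<close> through a third point
  \<open>z\<close>, the two distances dominate \<open>h x\<close> and \<open>h y\<close>
  respectively. Positivity of \<open>h\<close> separates points.\<close>

lemma Ultrametric_space_max_weight:
  fixes h :: "'a \<Rightarrow> real"
  assumes "\<And>x. h x > 0"
  shows "Ultrametric_space V (\<lambda>x y. if x = y then 0 else max (h x) (h y))"
    (is "Ultrametric_space V ?d")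
proof
  fix x y z
  show "?d x z \<le> ?d x y + ?d y z" and "?d x y \<le> max (?d x z) (?d z y)" and "0 \<le> ?d x y"
    and "?d x y = 0 \<longleftrightarrow> x = y"
    using assms[of x] assms[of y] assms[of z] by auto
qed (auto simp: max.commute)

text \<open>Distances are real, so an infinite diameter is never attained.\<close>

lemma ex_Ultrametric_space_no_diametrical_pair:
  assumes "infinite V"
  shows "\<exists>\<rho>. Ultrametric_space V \<rho> \<and> (\<forall>e. \<not> diametrical_pair \<rho> V e)"
proof -
  obtain f :: "nat \<Rightarrow> 'a" where f: "inj f" "range f \<subseteq> V"
    using assms infinite_countable_subset by blast
  \<comment> \<open>Here \<open>h (f n) = n + 1\<close>, so \<open>h\<close> is unbounded on
    \<open>V\<close>. Off the range of \<open>f\<close> the value of \<open>inv f\<close> is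
    arbitrary, but \<open>Suc\<close> keeps the weight positive.\<close>
  define h where "h x = real (Suc (inv f x))" for x
  define \<rho> where "\<rho> x y = (if x = y then 0 else max (h x) (h y))" for x y
  have "of_nat n \<le> diam \<rho> V" for n
  proof -
    have "real n \<le> \<rho> (f n) (f (Suc n))"
      using f(1) by (simp add: \<rho>_def h_def inj_eq)
    then have "ennreal (real n) \<le> ennreal (\<rho> (f n) (f (Suc n)))" by (rule ennreal_leI)
    also have "\<dots> \<le> diam \<rho> V" using f(2) by (intro diam_upper) auto
    finally show ?thesis by (simp add: ennreal_of_nat_eq_real_of_nat)
  qed
  then have "diam \<rho> V = top"
    using ennreal_Ex_less_of_nat[of "diam \<rho> V"] by (meson leD top.not_eq_extremum)
  then have "\<not> diametrical_pair \<rho> V e" for e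
    by (auto simp: diametrical_pair_def)
  moreover have "Ultrametric_space V \<rho>"
    unfolding \<rho>_def by (rule Ultrametric_space_max_weight) (simp add: h_def)
  ultimately show ?thesis by blast
qed

theorem theorem3p3:
  "(\<forall>(X :: 'a set) \<rho> E.
      Ultrametric_space X \<rho> \<longrightarrow> infinite X \<longrightarrow> simple_graph X E \<longrightarrow>
      (\<forall>u\<in>X. \<forall>v\<in>X. u \<noteq> v \<longrightarrow> ({u, v} \<in> E \<longleftrightarrow> diametrical_pair \<rho> X {u, v})) \<longrightarrow>
      complete_multipartite X E) \<and>
   (\<forall>(V :: 'a set) E.
      complete_multipartite V E \<longrightarrow> infinite V \<longrightarrow>
      (\<exists>\<rho>. Ultrametric_space V \<rho> \<and> E = {e. diametrical_pair \<rho> V e}))"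
proof (intro conjI allI impI)
  fix X :: "'a set" and \<rho> E
  assume "Ultrametric_space X \<rho>" "infinite X" "simple_graph X E"
    "\<forall>u\<in>X. \<forall>v\<in>X. u \<noteq> v \<longrightarrow> ({u, v} \<in> E \<longleftrightarrow> diametrical_pair \<rho> X {u, v})"
  then show "complete_multipartite X E"
    by (intro Ultrametric_space.complete_multipartite_diametrical) auto
next
  fix V :: "'a set" and E
  assume "complete_multipartite V E" "infinite V"
  then obtain P where part: "partition_on V P"
    and E: "\<And>e. e \<in> E \<longleftrightarrow> (\<exists>u\<in>V. \<exists>v\<in>V. e = {u, v} \<and> (\<forall>p\<in>P. \<not> {u, v} \<subseteq> p))"
    using complete_multipartite_obtain_partition by metis
  show "\<exists>\<rho>. Ultrametric_space V \<rho> \<and> E = {e. diametrical_pair \<rho> V e}"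
  proof (cases "E = {}")
    case True
    then show ?thesis
      using ex_Ultrametric_space_no_diametrical_pair[OF \<open>infinite V\<close>] by auto
  next
    case False
    then obtain e where "e \<in> E" by blast
    then have "\<exists>u\<in>V. \<exists>v\<in>V. \<forall>p\<in>P. \<not> {u, v} \<subseteq> p"
      unfolding E by blast
    note dp = diametrical_pair_partition[OF this part]
    show ?thesis
      \<comment> \<open>The witness stays schematic until \<open>Ultrametric_space_partition\<close>
        instantiates it with the distance that \<open>dp\<close> speaks about.\<close>
      by (rule exI, rule conjI, rule Ultrametric_space_partition[OF part])
        (unfold dp, simp add: set_eq_iff E)
  qed
qed

end
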